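(* Let $N\geq 1$ be a positive integer, let $\zeta_N = e^{2\pi i/N}$, and let $X$ be an indeterminate. Let \[ C'_N=\left\{\begin{pmatrix} a & b \\ 0 & d\end{pmatrix} : a,b,d\in\mathbb{Z},\ ad=N,\ a\geq 1,\ 0\leq b\leq d-1\right\}, \] and let $\sigma(N)=\sum_{d\mid N} d$ (so that $\sigma(N)=\#C'_N$). Then, as formal power series in $X$ with coefficients in $\mathbb{Q}(\zeta_N)$, \[ \prod_{\begin{pmatrix} a & b \\ 0 & d\end{pmatrix}\in C'_N}\left(1+\sum_{n=1}^{\infty}\zeta_N^{abn}\,p(n)\,X^{a^2 n}\right) = \left(1+\sum_{n=1}^{\infty}p(n)\,X^{Nn}\right)^{\sigma(N)}. \]
   Context: For a positive integer $n$, $p(n)$ denotes the number of partitions of $n$, i.e. the number of ways of writing $n$ as a sum of positive integers, where sums differing only in the order of terms are identified. *)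

theory Defs
  imports "HOL-Analysis.Analysis" "HOL-Library.Multiset"
begin

text \<open>
  A partition of \<open>n\<close> is a finite multiset of positive integers with sum \<open>n\<close>. Excluding the part
  \<open>0\<close> makes the set of partitions finite, so that \<open>card\<close> is the actual number of them.
\<close>
definition partitions :: "nat \<Rightarrow> nat multiset set" where
  "partitions n = {M. (\<forall>k \<in># M. k \<ge> 1) \<and> sum_mset M = n}"

definition partition_number :: "nat \<Rightarrow> nat" where
  "partition_number n = card (partitions n)"

lemma finite_partitions: "finite (partitions n)"
proof -
  have "size M \<le> sum_mset M" if "\<forall>k \<in># M. k \<ge> 1" for M :: "nat multiset"
    using that by (induction M) auto
  moreover have "k \<le> sum_mset M" if "k \<in># M" for k and M :: "nat multiset"
    using that by (metis le_add1 multi_member_split sum_mset.add_mset)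
  ultimately have *: "set_mset M \<subseteq> {..n} \<and> size M \<le> n" if "M \<in> partitions n" for M
    using that unfolding partitions_def by blast
  have "partitions n \<subseteq> mset ` {xs. set xs \<subseteq> {..n} \<and> length xs \<le> n}"
  proof
    fix M assume M: "M \<in> partitions n"
    obtain xs where "M = mset xs"
      using ex_mset[of M] by blast
    then show "M \<in> mset ` {xs. set xs \<subseteq> {..n} \<and> length xs \<le> n}"
      using *[OF M] by auto
  qed
  then show ?thesis
    using finite_lists_length_le[of "{..n}" n] by (meson finite_atMost finite_imageI finite_subset)
qed

definition zeta :: "nat \<Rightarrow> complex" where
  "zeta N = exp (2 * of_real pi * \<i> / of_nat N)"

definition divisor_sigma :: "nat \<Rightarrow> nat" where
  "divisor_sigma N = (\<Sum>d | d dvd N. d)"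

definition C' :: "nat \<Rightarrow> (int ^ 2 ^ 2) set" where
  "C' N = {vector [vector [a, b], vector [0, d]] | a b d :: int.
             a * d = int N \<and> a \<ge> 1 \<and> 0 \<le> b \<and> b \<le> d - 1}"

definition is_subfield :: "complex set \<Rightarrow> bool" where
  "is_subfield K \<longleftrightarrow> 0 \<in> K \<and> 1 \<in> K \<and>
     (\<forall>x\<in>K. \<forall>y\<in>K. x + y \<in> K \<and> x * y \<in> K) \<and> (\<forall>x\<in>K. - x \<in> K \<and> inverse x \<in> K)"

text \<open>
  \<open>\<rat>(\<zeta>\<^sub>N)\<close>, realised inside the complex numbers as the least subfield containing \<open>\<zeta>\<^sub>N\<close>; every
  subfield of the complex numbers contains \<open>\<rat>\<close>.
\<close>
definition cyclotomic_field :: "nat \<Rightarrow> complex set" where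
  "cyclotomic_field N = \<Inter>{K. is_subfield K \<and> zeta N \<in> K}"

definition fps_over :: "complex set \<Rightarrow> complex fps set" where
  "fps_over K = {F. \<forall>n. fps_nth F n \<in> K}"

text \<open>
  The infinite sums are taken in the \<open>X\<close>-adic topology of the ring of formal power series. The
  exponent \<open>a * b * n\<close> of \<open>\<zeta>\<^sub>N\<close> is an integer, whence \<open>powi\<close>. The conversion \<open>nat (a\<^sup>2)\<close> loses
  nothing as \<open>a\<^sup>2 \<ge> 0\<close>.
\<close>
definition twisted_partition_series :: "nat \<Rightarrow> int ^ 2 ^ 2 \<Rightarrow> complex fps" where
  "twisted_partition_series N A = (let a = A $ 1 $ 1; b = A $ 1 $ 2 in
     1 + (\<Sum>\<^sub>\<infinity>n\<in>{1..}. fps_const (zeta N powi (a * b * int n) * of_nat (partition_number n))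
                            * fps_X ^ (nat (a\<^sup>2) * n)))"

definition partition_series :: "nat \<Rightarrow> complex fps" where
  "partition_series N =
     1 + (\<Sum>\<^sub>\<infinity>n\<in>{1..}. fps_const (of_nat (partition_number n)) * fps_X ^ (N * n))"

text \<open>
  Both sums converge (for \<open>a\<^sup>2 \<ge> 1\<close> and \<open>N \<ge> 1\<close> respectively), so the value \<open>0\<close> that \<open>infsum\<close>
  takes on non-summable families never intervenes.
\<close>
lemma summable_on_fps_monomials:
  fixes c :: "nat \<Rightarrow> complex"
  assumes "k \<ge> 1"
  shows "(\<lambda>n. fps_const (c n) * fps_X ^ (k * n)) summable_on A"
proof -
  let ?F = "\<lambda>n. fps_const (c n) * fps_X ^ (k * n)"
  have "finite {n \<in> A. fps_nth (?F n) m \<noteq> 0}" for m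
  proof (rule finite_subset)
    show "{n \<in> A. fps_nth (?F n) m \<noteq> 0} \<subseteq> {..m}"
      using assms by (auto simp: fps_X_power_nth split: if_splits)
  qed simp
  then have "(?F has_sum Abs_fps (\<lambda>m. \<Sum>n | n \<in> A \<and> fps_nth (?F n) m \<noteq> 0. fps_nth (?F n) m)) A"
    by (intro has_sum_fpsI) simp_all
  then show ?thesis
    by (rule has_sum_imp_summable)
qed

end

theory Submission
  imports Defs
begin

text \<open>
  Let \<open>P = (\<Sum>n. p(n) X\<^sup>n)\<close>. A power series with constant term 1 is determined by its logarithmic
  derivative \<open>L F = X F' / F\<close>, which turns products into sums and satisfies
  \<open>L (P(c X\<^sup>k)) = k (L P)(c X\<^sup>k)\<close>. Counting parts of partitions gives \<open>L P = (\<Sum>n. \<sigma>(n) X\<^sup>n)\<close>. The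
  factor of \<open>(a, b, d)\<close> is \<open>P(\<zeta>\<^bsup>ab\<^esup> X\<^bsup>a\<^sup>2\<^esup>)\<close>; summing its logarithmic derivative over \<open>b\<close> keeps the
  exponents divisible by \<open>N a\<close>, and comparing coefficients of \<open>X\<^bsup>Nn\<^esup>\<close> leaves the Hecke relation
  \<open>(\<Sum>a dvd gcd N n. a \<sigma>(N n / a\<^sup>2)) = \<sigma>(N) \<sigma>(n)\<close>.
\<close>

section \<open>The logarithmic derivative of a formal power series\<close>

lemma fps_nth_compose_monomial:
  fixes f :: "'a :: field fps"
  assumes "k \<ge> 1"
  shows "fps_nth (f oo (fps_const c * fps_X ^ k)) n = (if k dvd n then c ^ (n div k) * fps_nth f (n div k) else 0)"
proof -
  have pow: "(fps_const c * fps_X ^ k) ^ i = fps_const (c ^ i) * fps_X ^ (k * i)" for i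
    by (simp only: power_mult_distrib fps_const_power power_mult)
  have "fps_nth (f oo (fps_const c * fps_X ^ k)) n = (\<Sum>i=0..n. fps_nth f i * (c ^ i * (if n = k * i then 1 else 0)))"
    unfolding fps_compose_nth pow
    by (intro sum.cong) simp_all
  also have "\<dots> = (\<Sum>i\<in>{i. i \<le> n \<and> n = k * i}. fps_nth f i * c ^ i)"
    by (intro sum.mono_neutral_cong_right) auto
  also have "{i. i \<le> n \<and> n = k * i} = (if k dvd n then {n div k} else {})"
    using assms by (auto simp: dvd_def)
  finally show ?thesis
    by simp
qed

lemma fps_nth_compose_X_power:
  fixes f :: "'a :: field fps"
  assumes "k \<ge> 1"
  shows "fps_nth (f oo fps_X ^ k) n = (if k dvd n then fps_nth f (n div k) else 0)"
  using fps_nth_compose_monomial[OF assms, of f 1 n] by simp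

text \<open>\<open>X F' = F G\<close> is a division-free way to say that the logarithmic derivative of \<open>F\<close> is \<open>G\<close>.\<close>
lemma log_deriv_compose_monomial:
  fixes F G :: "'a :: field fps" and c :: 'a
  assumes "k \<ge> 1" and FG: "fps_X * fps_deriv F = F * G"
  defines "B \<equiv> fps_const c * fps_X ^ k"
  shows "fps_X * fps_deriv (F oo B) = (F oo B) * (of_nat k * (G oo B))"
proof -
  have B0: "fps_nth B 0 = 0"
    using assms(1) by (simp add: B_def)
  \<comment> \<open>Monomials of degree \<open>k\<close> are eigenvectors of X d/dX with eigenvalue
    \<open>k\<close>; this is where the factor \<open>of_nat k\<close> in the chain rule comes
    from.\<close>
  have XB: "fps_X * fps_deriv B = of_nat k * B"
  proof (rule fps_ext)
    fix n
    show "fps_nth (fps_X * fps_deriv B) n = fps_nth (of_nat k * B) n"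
      using assms(1) by (cases n) (auto simp: B_def)
  qed
  have "fps_X * fps_deriv (F oo B) = (fps_deriv F oo B) * (fps_X * fps_deriv B)"
    using B0 by (simp add: fps_compose_deriv algebra_simps)
  also have "\<dots> = of_nat k * ((fps_X * fps_deriv F) oo B)"
    using B0 by (simp add: XB fps_compose_mult_distrib algebra_simps)
  also have "\<dots> = (F oo B) * (of_nat k * (G oo B))"
    using B0 by (simp add: FG fps_compose_mult_distrib algebra_simps)
  finally show ?thesis .
qed

lemma log_deriv_prod:
  fixes F G :: "'i \<Rightarrow> 'a :: comm_ring_1 fps"
  assumes "\<And>i. i \<in> I \<Longrightarrow> fps_X * fps_deriv (F i) = F i * G i"
  shows "fps_X * fps_deriv (\<Prod>i\<in>I. F i) = (\<Prod>i\<in>I. F i) * (\<Sum>i\<in>I. G i)"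
  using assms
proof (induction I rule: infinite_finite_induct)
  case (insert i I)
  have "fps_X * fps_deriv (\<Prod>i\<in>insert i I. F i)
      = (fps_X * fps_deriv (F i)) * (\<Prod>i\<in>I. F i) + F i * (fps_X * fps_deriv (\<Prod>i\<in>I. F i))"
    using insert.hyps by (simp add: algebra_simps)
  also have "fps_X * fps_deriv (F i) = F i * G i"
    using insert.prems by simp
  also have "fps_X * fps_deriv (\<Prod>i\<in>I. F i) = (\<Prod>i\<in>I. F i) * (\<Sum>i\<in>I. G i)"
    using insert.IH insert.prems by simp
  finally show ?case
    using insert.hyps by (simp add: algebra_simps)
qed auto

lemma fps_prod_nth_0:
  fixes F :: "'i \<Rightarrow> 'a :: comm_ring_1 fps"
  shows "fps_nth (\<Prod>i\<in>I. F i) 0 = (\<Prod>i\<in>I. fps_nth (F i) 0)"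
  by (induction I rule: infinite_finite_induct) auto

text \<open>The quotient F / H has logarithmic derivative G - G = 0, so its derivative vanishes. In
  characteristic 0 it is therefore constant, and the constant terms make it 1.\<close>

lemma fps_eqI_log_deriv:
  fixes F H :: "'a :: field_char_0 fps"
  assumes F: "fps_X * fps_deriv F = F * G" and H: "fps_X * fps_deriv H = H * G"
    and F0: "fps_nth F 0 = 1" and H0: "fps_nth H 0 = 1"
  shows "F = H"
proof -
  have inv: "inverse H * H = 1"
    using H0 by (intro inverse_mult_eq_1) simp
  have "fps_X * fps_deriv (F * inverse H)
      = (fps_X * fps_deriv F) * inverse H - F * (fps_X * fps_deriv H) * (inverse H)\<^sup>2"
    using H0 by (simp add: fps_inverse_deriv algebra_simps)
  also have "\<dots> = F * G * inverse H * (1 - inverse H * H)"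
    by (simp add: F H algebra_simps power2_eq_square)
  finally have "fps_deriv (F * inverse H) = 0"
    by (simp add: inv)
  then have "F * inverse H = fps_const 1"
    unfolding fps_deriv_eq_0_iff using F0 H0 by simp
  then have "F * (inverse H * H) = H"
    by (metis fps_const_1_eq_1 mult.assoc mult_1)
  then show ?thesis
    by (simp add: inv)
qed

section \<open>Divisor sums and the partition function\<close>

lemma partition_number_0: "partition_number 0 = 1"
proof -
  have "partitions 0 = {{#}}"
    by (auto simp: partitions_def sum_mset_0_iff) (metis One_nat_def multiset_nonemptyE not_one_le_zero)
  then show ?thesis
    by (simp add: partition_number_def)
qed

text \<open>Every number divides 0, so the defining sum ranges over an infinite set and takes the
  default value 0. This is the value wanted: X F' / F has no constant term.\<close>

lemma divisor_sigma_0 [simp]: "divisor_sigma 0 = 0"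
  by (simp add: divisor_sigma_def)

lemma sum_mset_eq_sum_count:
  fixes M :: "nat multiset"
  assumes "finite A" "set_mset M \<subseteq> A"
  shows "sum_mset M = (\<Sum>k\<in>A. k * count M k)"
  using assms(2)
proof (induction M)
  case (add x M)
  have "(\<Sum>k\<in>A. k * count (add_mset x M) k) = (\<Sum>k\<in>A. k * count M k + (if k = x then x else 0))"
    by (intro sum.cong) auto
  also have "\<dots> = sum_mset (add_mset x M)"
    using add assms(1) by (simp add: sum.distrib)
  finally show ?case ..
qed simp

text \<open>Removing \<open>j\<close> copies of the part \<open>k\<close> is a bijection onto the
  partitions of \<open>n - j * k\<close>, with adding them back as its inverse.\<close>

lemma card_partitions_count_ge:
  assumes "k \<ge> 1" "j * k \<le> n"
  shows "card {M \<in> partitions n. j \<le> count M k} = partition_number (n - j * k)"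
proof -
  have "bij_betw (\<lambda>M. M + replicate_mset j k) (partitions (n - j * k)) {M \<in> partitions n. j \<le> count M k}"
  proof (rule bij_betwI[where g = "\<lambda>M. M - replicate_mset j k"])
    show "(\<lambda>M. M + replicate_mset j k) \<in> partitions (n - j * k) \<rightarrow> {M \<in> partitions n. j \<le> count M k}"
      using assms by (auto simp: partitions_def)
    show "(\<lambda>M. M - replicate_mset j k) \<in> {M \<in> partitions n. j \<le> count M k} \<rightarrow> partitions (n - j * k)"
      by (auto simp: partitions_def sum_mset_diff count_le_replicate_mset_subset_eq dest: in_diffD)
    show "M - replicate_mset j k + replicate_mset j k = M" if "M \<in> {M \<in> partitions n. j \<le> count M k}" for M
      using that by (simp add: count_le_replicate_mset_subset_eq)
  qed simp
  then show ?thesis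
    unfolding partition_number_def by (metis bij_betw_same_card)
qed

lemma count_le_of_partition:
  assumes "M \<in> partitions n" "j \<le> count M k"
  shows "j * k \<le> n"
proof -
  have "replicate_mset j k \<subseteq># M"
    using assms(2) by (simp add: count_le_replicate_mset_subset_eq)
  then obtain M' where "M = replicate_mset j k + M'"
    by (auto simp: mset_subset_eq_exists_conv)
  then show ?thesis
    using assms(1) by (auto simp: partitions_def)
qed

text \<open>Double counting of the total of all parts in all partitions of \<open>n\<close>. A part
  \<open>k\<close> contributes once for each \<open>j\<close> up to its multiplicity, and for fixed
  \<open>(k, j)\<close> there are p(n - jk) such partitions. Collecting the pairs with jk = i
  produces the divisor sum of \<open>i\<close>.\<close>

lemma partition_number_recurrence:
  "n * partition_number n = (\<Sum>i=0..n. partition_number i * divisor_sigma (n - i))"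
proof -
  have factor_le: "a \<le> n" "b \<le> n" if "a * b \<le> n" "a > 0" "b > 0" for a b
    using that by (cases a; cases b; simp)+
  have "n * partition_number n = (\<Sum>M\<in>partitions n. sum_mset M)"
    by (simp add: partition_number_def partitions_def)
  also have "\<dots> = (\<Sum>M\<in>partitions n. \<Sum>k=1..n. \<Sum>j=1..n. if j \<le> count M k then k else 0)"
  proof (rule sum.cong)
    fix M assume M: "M \<in> partitions n"
    have "set_mset M \<subseteq> {1..n}"
    proof
      fix k assume "k \<in># M"
      then have "k \<ge> 1" "1 * k \<le> n"
        using M count_le_of_partition[OF M, of 1 k] by (auto simp: partitions_def)
      then show "k \<in> {1..n}"
        by simp
    qed
    then have "sum_mset M = (\<Sum>k=1..n. k * count M k)"
      by (intro sum_mset_eq_sum_count) auto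
    also have "\<dots> = (\<Sum>k=1..n. \<Sum>j=1..n. if j \<le> count M k then k else 0)"
    proof (rule sum.cong)
      fix k assume k: "k \<in> {1..n}"
      \<comment> \<open>The multiplicity is at most \<open>n\<close>, so cutting \<open>j\<close>
        off at \<open>n\<close> loses nothing. The range of \<open>j\<close> is then independent of
        \<open>M\<close>, which permits swapping the sums.\<close>
      have "count M k * 1 \<le> count M k * k"
        using k by (intro mult_le_mono) auto
      also have "\<dots> \<le> n"
        by (rule count_le_of_partition[OF M]) simp
      finally have "{j\<in>{1..n}. j \<le> count M k} = {1..count M k}"
        by auto
      then have "(\<Sum>j=1..n. if j \<le> count M k then k else 0) = (\<Sum>j=1..count M k. k)"
        by (simp flip: sum.inter_filter)
      then show "k * count M k = (\<Sum>j=1..n. if j \<le> count M k then k else 0)"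
        by simp
    qed simp
    finally show "sum_mset M = (\<Sum>k=1..n. \<Sum>j=1..n. if j \<le> count M k then k else 0)" .
  qed simp
  also have "\<dots> = (\<Sum>k=1..n. \<Sum>j=1..n. \<Sum>M\<in>partitions n. if j \<le> count M k then k else 0)"
    by (subst sum.swap, rule sum.cong[OF refl], subst sum.swap) simp
  also have "\<dots> = (\<Sum>k=1..n. \<Sum>j=1..n. if j * k \<le> n then k * partition_number (n - j * k) else 0)"
  proof (intro sum.cong refl)
    fix k j assume "k \<in> {1..n}" "j \<in> {1..n}"
    have "(\<Sum>M\<in>partitions n. if j \<le> count M k then k else 0) = k * card {M \<in> partitions n. j \<le> count M k}"
      by (simp add: finite_partitions flip: sum.inter_filter)
    also have "\<dots> = (if j * k \<le> n then k * partition_number (n - j * k) else 0)"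
    proof (cases "j * k \<le> n")
      case True
      with \<open>k \<in> {1..n}\<close> show ?thesis
        by (simp add: card_partitions_count_ge)
    next
      case False
      then have "{M \<in> partitions n. j \<le> count M k} = {}"
        using count_le_of_partition by blast
      with False show ?thesis
        by (simp only: card.empty) simp
    qed
    finally show "(\<Sum>M\<in>partitions n. if j \<le> count M k then k else 0)
      = (if j * k \<le> n then k * partition_number (n - j * k) else 0)" .
  qed
  also have "\<dots> = (\<Sum>(k,j)\<in>{(k,j)\<in>{1..n}\<times>{1..n}. j * k \<le> n}. k * partition_number (n - j * k))"
    unfolding sum.cartesian_product
    by (intro sum.mono_neutral_cong_right) (auto split: if_splits)
  \<comment> \<open>Put i = jk; then \<open>k\<close> runs over all divisors of \<open>i\<close>,
    with j = i / k.\<close>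
  also have "\<dots> = (\<Sum>(i,k)\<in>Sigma {1..n} (\<lambda>i. {k. k dvd i}). k * partition_number (n - i))"
    by (intro sum.reindex_bij_witness[of _ "\<lambda>(i,k). (k, i div k)" "\<lambda>(k,j). (j * k, k)"])
       (auto simp: Suc_le_eq mult.commute elim!: dvdE intro: factor_le)
  also have "\<dots> = (\<Sum>i=1..n. \<Sum>k | k dvd i. k * partition_number (n - i))"
    by (intro sum.Sigma[symmetric]) auto
  also have "\<dots> = (\<Sum>i=1..n. partition_number (n - i) * divisor_sigma i)"
    by (simp add: divisor_sigma_def sum_distrib_left mult.commute)
  also have "\<dots> = (\<Sum>i=0..n. partition_number (n - i) * divisor_sigma i)"
    by (intro sum.mono_neutral_left) (auto simp: not_less_eq_eq)
  also have "\<dots> = (\<Sum>i=0..n. partition_number i * divisor_sigma (n - i))"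
    by (rule sum.reindex_bij_witness[of _ "\<lambda>i. n - i" "\<lambda>i. n - i"]) auto
  finally show ?thesis .
qed

text \<open>
  Both sides sum \<open>g * k\<close> over pairs with \<open>g dvd N\<close> and \<open>k dvd n\<close>, grouped on the left by
  \<open>a = gcd k (N div g)\<close>; the divisor of \<open>(N div a) * (n div a)\<close> attached to \<open>(g, k)\<close> is
  \<open>g * (k div a)\<close>, and \<open>g\<close> is recovered from it as its gcd with \<open>N div a\<close>.
\<close>
lemma divisor_sigma_mult:
  assumes "N \<ge> 1" "n \<ge> 1"
  shows "(\<Sum>a | a dvd N \<and> a dvd n. a * divisor_sigma ((N div a) * (n div a))) = divisor_sigma N * divisor_sigma n"
proof -
  let ?A = "{a. a dvd N \<and> a dvd n}"
  let ?D = "\<lambda>a. {e. e dvd (N div a) * (n div a)}"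
  let ?from = "\<lambda>(g, k). let a = gcd k (N div g) in (a, g * (k div a))"
  let ?to = "\<lambda>(a, e). let g = gcd e (N div a) in (g, a * (e div g))"
  have fin: "finite (?D a)" if "a \<in> ?A" for a
    using assms that by (intro finite_divisors_nat) (auto elim!: dvdE)
  have "(\<Sum>a\<in>?A. a * divisor_sigma ((N div a) * (n div a))) = (\<Sum>(a,e)\<in>Sigma ?A ?D. a * e)"
    unfolding divisor_sigma_def sum_distrib_left using assms fin by (subst sum.Sigma) auto
  also have "\<dots> = (\<Sum>(g,k)\<in>{g. g dvd N} \<times> {k. k dvd n}. g * k)"
  proof (intro sum.reindex_bij_witness[of _ ?from ?to])
    fix x assume "x \<in> Sigma ?A ?D"
    then obtain a e where x: "x = (a, e)" and a: "a dvd N" "a dvd n"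
      and e: "e dvd (N div a) * (n div a)" by auto
    define g where "g = gcd e (N div a)"
    from a obtain d m where d: "N = a * d" and m: "n = a * m" by (auto elim!: dvdE)
    have pos: "a > 0" "d > 0" "m > 0" using assms d m by auto
    have g: "g = gcd e d" using d pos by (simp add: g_def)
    have gpos: "g > 0" using pos g by simp
    obtain e' d' where e': "e = e' * g" and d': "d = d' * g" and cop: "coprime e' d'"
      using gcd_coprime_exists[of e d] gpos unfolding g by blast
    \<comment> \<open>Cancelling \<open>g\<close> and using that \<open>e'\<close> and
      \<open>d'\<close> are coprime gives \<open>e' dvd m\<close>; hence \<open>a * e'\<close>
      divides n = a m.\<close>
    have "e dvd d * m" using e d m pos by simp
    then have "e' * g dvd d' * g * m" using e' d' by metis
    then have "e' dvd d' * m" using gpos by (simp add: ac_simps)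
    then have e'm: "e' dvd m" using cop by (simp add: coprime_dvd_mult_right_iff)
    have Ng: "N div g = a * d'" using d d' gpos by simp
    have gcd': "gcd (a * e') (N div g) = a"
      using cop by (simp add: Ng gcd_mult_distrib_nat[symmetric])
    have e_div: "e div g = e'" using e' gpos by simp
    have to: "?to x = (g, a * e')" by (simp add: x Let_def e_div flip: g_def)
    show "?to x \<in> {g. g dvd N} \<times> {k. k dvd n}"
      unfolding to using e'm d d' m by simp
    show "?from (?to x) = x"
      unfolding to unfolding x using gcd' e' pos by (simp add: mult.commute)
    show "(case ?to x of (g, k) \<Rightarrow> g * k) = (case x of (a, e) \<Rightarrow> a * e)"
      unfolding to unfolding x using e' by simp
  next
    fix y assume "y \<in> {g. g dvd N} \<times> {k. k dvd n}"
    then obtain g k where y: "y = (g, k)" and g: "g dvd N" and k: "k dvd n" by auto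
    from g obtain c where c: "N = g * c" by (auto elim!: dvdE)
    have pos: "g > 0" "c > 0" "k > 0" using assms c k by (auto intro: Nat.gr0I)
    define a where "a = gcd k (N div g)"
    have a: "a = gcd k c" using c pos by (simp add: a_def)
    have apos: "a > 0" using a pos by simp
    obtain k' c' where k': "k = k' * a" and c': "c = c' * a" and cop: "coprime k' c'"
      using gcd_coprime_exists[of k c] apos unfolding a by blast
    obtain m where m: "n = k' * a * m" using k k' by (auto elim!: dvdE)
    have Na: "N div a = g * c'" using c c' apos by (simp add: ac_simps)
    have na: "n div a = k' * m" using m apos by (simp add: ac_simps)
    have gcd': "gcd (g * k') (N div a) = g"
      using cop by (simp add: Na gcd_mult_distrib_nat[symmetric])
    have k_div: "k div a = k'" using k' apos by simp
    have "from": "?from y = (a, g * k')" by (simp add: y Let_def k_div flip: a_def)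
    have "a dvd N" "a dvd n" "g * k' dvd N div a * (n div a)"
      using c c' m by (auto simp: Na na mult_dvd_mono)
    then show "?from y \<in> Sigma ?A ?D"
      unfolding "from" by simp
    show "?to (?from y) = y"
      unfolding "from" unfolding y using gcd' k' pos by (simp add: mult.commute)
  qed
  also have "\<dots> = divisor_sigma N * divisor_sigma n"
    by (simp add: divisor_sigma_def sum_product sum.cartesian_product)
  finally show ?thesis .
qed

section \<open>Generating series of the partition numbers and of the divisor sums\<close>

definition partition_fps :: "complex fps" where
  "partition_fps = Abs_fps (\<lambda>n. of_nat (partition_number n))"

definition divisor_sigma_fps :: "complex fps" where
  "divisor_sigma_fps = Abs_fps (\<lambda>n. of_nat (divisor_sigma n))"

lemma fps_nth_partition_fps_0 [simp]: "fps_nth partition_fps 0 = 1"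
  by (simp add: partition_fps_def partition_number_0)

lemma log_deriv_partition_fps: "fps_X * fps_deriv partition_fps = partition_fps * divisor_sigma_fps"
proof (rule fps_ext)
  fix n
  have "fps_nth (fps_X * fps_deriv partition_fps) n = of_nat (n * partition_number n)"
    by (cases n) (simp_all add: partition_fps_def algebra_simps)
  also have "\<dots> = fps_nth (partition_fps * divisor_sigma_fps) n"
    unfolding partition_number_recurrence by (simp add: fps_mult_nth partition_fps_def divisor_sigma_fps_def)
  finally show "fps_nth (fps_X * fps_deriv partition_fps) n = fps_nth (partition_fps * divisor_sigma_fps) n" .
qed

text \<open>Replaces the X-adic infinite sums by formal composition. Each coefficient receives at
  most one nonzero contribution, and the leading 1 is the constant term of \<open>F\<close>.\<close>

lemma one_plus_infsum_monomials:
  fixes F :: "complex fps"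
  assumes "k \<ge> 1" "fps_nth F 0 = 1"
  shows "1 + (\<Sum>\<^sub>\<infinity>n\<in>{1..}. fps_const (c ^ n * fps_nth F n) * fps_X ^ (k * n)) = F oo (fps_const c * fps_X ^ k)"
proof -
  let ?f = "\<lambda>n. fps_const (c ^ n * fps_nth F n) * fps_X ^ (k * n)"
  have supp: "{n \<in> {1..}. fps_nth (?f n) m \<noteq> 0} \<subseteq> {m div k}" for m
    using assms(1) by (auto split: if_splits)
  have "(?f has_sum ((F oo (fps_const c * fps_X ^ k)) - 1)) {1..}"
  proof (rule has_sum_fpsI)
    fix m
    show "finite {n \<in> {1..}. fps_nth (?f n) m \<noteq> 0}"
      using finite_subset[OF supp] by blast
    have "(\<Sum>n | n \<in> {1..} \<and> fps_nth (?f n) m \<noteq> 0. fps_nth (?f n) m)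
        = (\<Sum>n\<in>{m div k}. if n \<ge> 1 then fps_nth (?f n) m else 0)"
      using supp by (intro sum.mono_neutral_cong_left) auto
    also have "\<dots> = fps_nth ((F oo (fps_const c * fps_X ^ k)) - 1) m"
    proof (cases "k dvd m")
      case True
      then show ?thesis
        using assms by (auto simp: fps_nth_compose_monomial Suc_le_eq elim!: dvdE)
    next
      case False
      then have "m \<noteq> k * (m div k)" "m \<noteq> 0"
        by (metis dvd_triv_left, metis dvd_0_right)
      then show ?thesis
        using False assms by (simp add: fps_nth_compose_monomial)
    qed
    finally show "fps_nth ((F oo (fps_const c * fps_X ^ k)) - 1) m
        = (\<Sum>n | n \<in> {1..} \<and> fps_nth (?f n) m \<noteq> 0. fps_nth (?f n) m)" ..
  qed
  then show ?thesis
    by (simp add: infsumI)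
qed

lemma partition_series_eq:
  assumes "N \<ge> 1"
  shows "partition_series N = partition_fps oo fps_X ^ N"
  using one_plus_infsum_monomials[OF assms, of partition_fps 1]
  by (simp add: partition_series_def partition_fps_def partition_number_0)

section \<open>The matrices\<close>

text \<open>Since d = N / a, the pair \<open>(a, b)\<close> determines the matrix. Natural number
  indices turn products over \<open>C' N\<close> into iterated ones over divisors \<open>a\<close>
  and residues \<open>b\<close>.\<close>

definition upper_matrix :: "nat \<Rightarrow> nat \<times> nat \<Rightarrow> int ^ 2 ^ 2" where
  "upper_matrix N = (\<lambda>(a, b). vector [vector [int a, int b], vector [0, int (N div a)]])"

lemma bij_betw_upper_matrix:
  assumes "N \<ge> 1"
  shows "bij_betw (upper_matrix N) (SIGMA a:{a. a dvd N}. {..<N div a}) (C' N)"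
proof (rule bij_betw_imageI)
  show "inj_on (upper_matrix N) (SIGMA a:{a. a dvd N}. {..<N div a})"
    by (auto simp: inj_on_def upper_matrix_def vec_eq_iff forall_2)
  show "upper_matrix N ` (SIGMA a:{a. a dvd N}. {..<N div a}) = C' N"
  proof (intro equalityI subsetI)
    fix A assume "A \<in> upper_matrix N ` (SIGMA a:{a. a dvd N}. {..<N div a})"
    then obtain a b where A: "A = upper_matrix N (a, b)" and a: "a dvd N" and b: "b < N div a"
      by auto
    have "int a * int (N div a) = int N" "int a \<ge> 1" "int b \<le> int (N div a) - 1"
      using a b assms by (auto simp flip: of_nat_mult intro: Nat.gr0I simp: Suc_le_eq)
    then show "A \<in> C' N"
      unfolding C'_def A upper_matrix_def by force
  next
    fix A assume "A \<in> C' N"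
    then obtain a b d where A: "A = vector [vector [a, b], vector [0, d]]"
      and ad: "a * d = int N" and a: "a \<ge> 1" and b: "0 \<le> b" "b \<le> d - 1"
      unfolding C'_def by blast
    have N: "N = nat a * nat d"
      using ad a by (metis nat_int nat_mult_distrib order_trans zero_le_one)
    have d: "N div nat a = nat d"
      using N a by simp
    have "A = upper_matrix N (nat a, nat b)"
      using a b by (simp add: A upper_matrix_def d)
    moreover have "nat a dvd N" "nat b < N div nat a"
      using N b d by auto
    ultimately show "A \<in> upper_matrix N ` (SIGMA a:{a. a dvd N}. {..<N div a})"
      by auto
  qed
qed

text \<open>Each divisor \<open>a\<close> admits N / a values of \<open>b\<close>, and
  \<open>a\<close> \<mapsto> N / a permutes the divisors of \<open>N\<close>.\<close>

lemma card_C':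
  assumes "N \<ge> 1"
  shows "card (C' N) = divisor_sigma N"
proof -
  have fin: "finite {a. a dvd N}"
    using assms by simp
  have "card (C' N) = (\<Sum>a | a dvd N. N div a)"
    using bij_betw_same_card[OF bij_betw_upper_matrix[OF assms]] fin by simp
  also have "\<dots> = divisor_sigma N"
    unfolding divisor_sigma_def using assms
    by (intro sum.reindex_bij_witness[of _ "\<lambda>d. N div d" "\<lambda>d. N div d"]) (auto elim!: dvdE)
  finally show ?thesis .
qed

lemma twisted_partition_series_upper_matrix:
  assumes "a \<ge> 1"
  shows "twisted_partition_series N (upper_matrix N (a, b))
    = partition_fps oo (fps_const (zeta N ^ (a * b)) * fps_X ^ a\<^sup>2)"
proof -
  have "zeta N powi (int a * int b * int n) = (zeta N ^ (a * b)) ^ n" for n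
    by (metis of_nat_mult power_int_of_nat power_mult)
  moreover have "nat ((int a)\<^sup>2) = a\<^sup>2"
    by (simp add: nat_power_eq)
  moreover have "a\<^sup>2 \<ge> 1"
    using assms by simp
  ultimately show ?thesis
    using one_plus_infsum_monomials[of "a\<^sup>2" partition_fps "zeta N ^ (a * b)"]
    by (simp add: twisted_partition_series_def upper_matrix_def partition_fps_def partition_number_0)
qed

text \<open>A geometric sum whose ratio \<zeta>^(an) is a d-th root of unity, equal to 1 exactly
  when \<open>d\<close> divides \<open>n\<close>.\<close>

lemma sum_powers_zeta:
  assumes "N = a * d" "N \<ge> 1"
  shows "(\<Sum>b<d. (zeta N ^ (a * b)) ^ n) = (if d dvd n then of_nat d else 0)"
proof -
  let ?w = "zeta N ^ (a * n)"
  have zeta_power: "zeta N ^ j = exp (2 * of_real pi * \<i> * of_nat j / of_nat N)" for j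
    by (simp add: zeta_def mult.commute flip: exp_of_nat_mult)
  have w1: "?w = 1 \<longleftrightarrow> d dvd n"
    unfolding zeta_power complex_root_unity_eq_1[OF assms(2)] using assms by simp
  have "zeta N ^ N = 1"
    unfolding zeta_power complex_root_unity_eq_1[OF assms(2)] by simp
  then have wd: "?w ^ d = 1"
    using assms by (metis mult.assoc mult.commute power_mult power_one)
  have "(\<Sum>b<d. (zeta N ^ (a * b)) ^ n) = (\<Sum>b<d. ?w ^ b)"
    by (intro sum.cong) (simp_all add: ac_simps flip: power_mult)
  also have "\<dots> = (if d dvd n then of_nat d else 0)"
    using wd w1 by (simp add: sum_gp_strict)
  finally show ?thesis .
qed

section \<open>Coefficients in the cyclotomic field\<close>

lemma is_subfield_cyclotomic_field: "is_subfield (cyclotomic_field N)"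
  unfolding cyclotomic_field_def is_subfield_def by blast

lemma zeta_in_cyclotomic_field: "zeta N \<in> cyclotomic_field N"
  unfolding cyclotomic_field_def by blast

lemma of_nat_in_subfield: "is_subfield K \<Longrightarrow> of_nat n \<in> K"
  by (induction n) (auto simp: is_subfield_def)

lemma power_in_subfield: "is_subfield K \<Longrightarrow> x \<in> K \<Longrightarrow> x ^ n \<in> K"
  by (induction n) (auto simp: is_subfield_def)

lemma partition_fps_compose_in_fps_over:
  assumes K: "is_subfield K" and "c \<in> K" "k \<ge> 1"
  shows "partition_fps oo (fps_const c * fps_X ^ k) \<in> fps_over K"
proof -
  have "0 \<in> K" "\<And>x y. x \<in> K \<Longrightarrow> y \<in> K \<Longrightarrow> x * y \<in> K"
    using K by (auto simp: is_subfield_def)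
  then show ?thesis
    using assms of_nat_in_subfield[OF K] power_in_subfield[OF K]
    by (auto simp: fps_over_def fps_nth_compose_monomial partition_fps_def)
qed

section \<open>The product identity\<close>

text \<open>Compares coefficients of X^m: orthogonality of roots of unity removes the sum over
  \<open>b\<close>, and \<open>divisor_sigma_mult\<close> evaluates the remaining sum over
  \<open>a\<close>.\<close>

lemma sum_log_deriv_twisted:
  assumes "N \<ge> 1"
  shows "(\<Sum>(a, b)\<in>(SIGMA a:{a. a dvd N}. {..<N div a}).
      of_nat (a\<^sup>2) * (divisor_sigma_fps oo (fps_const (zeta N ^ (a * b)) * fps_X ^ a\<^sup>2)))
    = of_nat (divisor_sigma N) * (of_nat N * (divisor_sigma_fps oo fps_X ^ N))"
    (is "?L = ?R")
proof (rule fps_ext)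
  fix m
  have fin: "finite {a. a dvd N}"
    using assms by simp
  have "fps_nth ?L m = (\<Sum>a | a dvd N. \<Sum>b<N div a.
      of_nat (a\<^sup>2) * (if a\<^sup>2 dvd m then (zeta N ^ (a * b)) ^ (m div a\<^sup>2) * of_nat (divisor_sigma (m div a\<^sup>2)) else 0))"
    unfolding fps_sum_nth using assms fin
    by (subst sum.Sigma)
       (auto intro!: sum.cong Nat.gr0I simp: fps_nth_compose_monomial divisor_sigma_fps_def Suc_le_eq
          simp del: of_nat_power)
  \<comment> \<open>With N = a d, the sum over \<open>b\<close> yields a factor \<open>d\<close> and
    the condition that \<open>d\<close> divides m / a^2. The weight becomes a^2 d = N a, and the two
    divisibility conditions merge into \<open>N * a dvd m\<close>.\<close>
  also have "\<dots> = (\<Sum>a | a dvd N. if N * a dvd m then of_nat (N * a * divisor_sigma (m div a\<^sup>2)) else 0)"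
  proof (intro sum.cong refl)
    fix a assume "a \<in> {a. a dvd N}"
    then obtain d where d: "N = a * d"
      by auto
    then have pos: "a > 0"
      using assms by (auto intro: Nat.gr0I)
    show "(\<Sum>b<N div a. of_nat (a\<^sup>2) * (if a\<^sup>2 dvd m
          then (zeta N ^ (a * b)) ^ (m div a\<^sup>2) * of_nat (divisor_sigma (m div a\<^sup>2)) else 0))
        = (if N * a dvd m then of_nat (N * a * divisor_sigma (m div a\<^sup>2)) else (0 :: complex))"
    proof (cases "a\<^sup>2 dvd m")
      case True
      then obtain q where q: "m = a\<^sup>2 * q" ..
      have "N * a dvd m \<longleftrightarrow> d dvd q"
        using pos by (simp add: d q power2_eq_square mult.commute mult.left_commute)
      moreover have "(\<Sum>b<d. of_nat (a\<^sup>2) * ((zeta N ^ (a * b)) ^ q * of_nat (divisor_sigma q)))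
          = of_nat (a\<^sup>2) * of_nat (divisor_sigma q) * (\<Sum>b<d. (zeta N ^ (a * b)) ^ q)"
        by (simp add: sum_distrib_left mult_ac)
      ultimately show ?thesis
        using pos d by (simp add: q sum_powers_zeta[OF d assms, unfolded d] power2_eq_square)
    next
      case False
      then have "\<not> N * a dvd m"
        by (metis d dvd_triv_left dvd_trans mult.assoc mult.commute power2_eq_square)
      with False show ?thesis
        by simp
    qed
  qed
  also have "\<dots> = fps_nth ?R m"
  proof (cases "N dvd m \<and> m > 0")
    case True
    then obtain n where n: "m = N * n" "n \<ge> 1"
      by (auto simp: Suc_le_eq)
    \<comment> \<open>For m = N n, the condition N a | N n means a | n, and m / a^2 = (N / a)(n /
      a).\<close>
    have "(\<Sum>a | a dvd N. if N * a dvd m then N * a * divisor_sigma (m div a\<^sup>2) else 0)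
        = (\<Sum>a | a dvd N \<and> a dvd n. N * (a * divisor_sigma ((N div a) * (n div a))))"
      using assms
      by (intro sum.mono_neutral_cong_right)
         (auto simp: n power2_eq_square div_mult_div_if_dvd)
    also have "\<dots> = N * (divisor_sigma N * divisor_sigma n)"
      using divisor_sigma_mult[OF assms n(2)] by (simp flip: sum_distrib_left)
    finally have "of_nat (\<Sum>a | a dvd N. if N * a dvd m then N * a * divisor_sigma (m div a\<^sup>2) else 0)
        = (of_nat (N * (divisor_sigma N * divisor_sigma n)) :: complex)"
      by (rule arg_cong)
    then show ?thesis
      using assms by (simp add: n if_distrib[of of_nat] divisor_sigma_fps_def fps_nth_compose_X_power
          mult_ac cong: if_cong)
  next
    \<comment> \<open>If \<open>N\<close> does not divide \<open>m\<close>, neither does any N a. If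
      m = 0, both sides vanish because \<open>divisor_sigma 0 = 0\<close>.\<close>
    case False
    then show ?thesis
      using assms by (auto simp: divisor_sigma_fps_def fps_nth_compose_X_power
          intro!: sum.neutral dest: dvd_mult_left)
  qed
  finally show "fps_nth ?L m = fps_nth ?R m" .
qed

theorem theorem1p2:
  fixes N :: nat
  assumes "N \<ge> 1"
  shows "card (C' N) = divisor_sigma N
    \<and> (\<forall>A \<in> C' N. twisted_partition_series N A \<in> fps_over (cyclotomic_field N))
    \<and> partition_series N \<in> fps_over (cyclotomic_field N)
    \<and> (\<Prod>A \<in> C' N. twisted_partition_series N A) = partition_series N ^ divisor_sigma N"
proof -
  let ?I = "SIGMA a:{a. a dvd N}. {..<N div a}"
  let ?T = "\<lambda>(a, b). fps_const (zeta N ^ (a * b)) * fps_X ^ a\<^sup>2"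
  note bij = bij_betw_upper_matrix[OF assms]
  note K = is_subfield_cyclotomic_field[of N]
  have pos: "a \<ge> 1" if "a dvd N" for a
    using that assms by (auto intro: Nat.gr0I simp: Suc_le_eq)
  have twisted: "twisted_partition_series N (upper_matrix N i) = partition_fps oo ?T i" if "i \<in> ?I" for i
    using that pos by (auto simp: twisted_partition_series_upper_matrix)
  have "twisted_partition_series N A \<in> fps_over (cyclotomic_field N)" if A: "A \<in> C' N" for A
  proof -
    obtain i where i: "i \<in> ?I" "A = upper_matrix N i"
      using A unfolding bij_betw_imp_surj_on[OF bij, symmetric] by blast
    obtain a b where ab: "i = (a, b)"
      by fastforce
    have "partition_fps oo ?T i \<in> fps_over (cyclotomic_field N)"
      using i pos unfolding ab
      by (auto intro!: partition_fps_compose_in_fps_over power_in_subfield K zeta_in_cyclotomic_field)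
    then show ?thesis
      using twisted i by simp
  qed
  moreover have "partition_series N \<in> fps_over (cyclotomic_field N)"
    using partition_fps_compose_in_fps_over[OF K, of 1 N] K assms
    by (simp add: partition_series_eq is_subfield_def)
  moreover have "(\<Prod>A \<in> C' N. twisted_partition_series N A) = partition_series N ^ divisor_sigma N"
  proof -
    have "(\<Prod>A \<in> C' N. twisted_partition_series N A) = (\<Prod>i\<in>?I. partition_fps oo ?T i)"
      using prod.reindex_bij_betw[OF bij, of "twisted_partition_series N"] twisted
      by (metis (no_types, lifting) prod.cong)
    \<comment> \<open>The power is written as a constant product so that
      \<open>log_deriv_prod\<close> handles both sides.\<close>
    also have "\<dots> = (\<Prod>i<divisor_sigma N. partition_fps oo fps_X ^ N)"
    proof (rule fps_eqI_log_deriv)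
      have "fps_X * fps_deriv (\<Prod>i\<in>?I. partition_fps oo ?T i)
          = (\<Prod>i\<in>?I. partition_fps oo ?T i) * (\<Sum>i\<in>?I. of_nat ((fst i)\<^sup>2) * (divisor_sigma_fps oo ?T i))"
        using pos
        by (intro log_deriv_prod) (auto intro!: log_deriv_compose_monomial log_deriv_partition_fps
            simp: Suc_le_eq simp del: of_nat_power)
      also have "(\<Sum>i\<in>?I. of_nat ((fst i)\<^sup>2) * (divisor_sigma_fps oo ?T i))
          = of_nat (divisor_sigma N) * (of_nat N * (divisor_sigma_fps oo fps_X ^ N))"
        unfolding sum_log_deriv_twisted[OF assms, symmetric] by (intro sum.cong) auto
      finally show "fps_X * fps_deriv (\<Prod>i\<in>?I. partition_fps oo ?T i)
          = (\<Prod>i\<in>?I. partition_fps oo ?T i) * (of_nat (divisor_sigma N) * (of_nat N * (divisor_sigma_fps oo fps_X ^ N)))" .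
      have "fps_X * fps_deriv (partition_fps oo fps_X ^ N)
          = (partition_fps oo fps_X ^ N) * (of_nat N * (divisor_sigma_fps oo fps_X ^ N))"
        using log_deriv_compose_monomial[OF assms log_deriv_partition_fps, of 1] by simp
      then show "fps_X * fps_deriv (\<Prod>i<divisor_sigma N. partition_fps oo fps_X ^ N)
          = (\<Prod>i<divisor_sigma N. partition_fps oo fps_X ^ N)
            * (of_nat (divisor_sigma N) * (of_nat N * (divisor_sigma_fps oo fps_X ^ N)))"
        using log_deriv_prod[of "{..<divisor_sigma N}" "\<lambda>_. partition_fps oo fps_X ^ N"
            "\<lambda>_. of_nat N * (divisor_sigma_fps oo fps_X ^ N)"] by simp
    qed (simp_all add: fps_prod_nth_0 del: prod_constant)
    finally show ?thesis
      by (simp add: partition_series_eq[OF assms])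
  qed
  ultimately show ?thesis
    using card_C'[OF assms] by (intro conjI ballI)
qed

end
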